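(* Let $\mathcal{H}$ be a complex Hilbert space and let $a,b,x,y\in\mathcal{H}$ be such that $\langle x,b\rangle\langle b,y\rangle\in\mathbb{R}$ and $(\langle x,b\rangle,\langle y,b\rangle)\neq(0,0)$. Define the real number $\mu$ as follows. If $|\langle a,b\rangle||\langle x,b\rangle|>\|a\|\|b\||\langle y,b\rangle|$, put \[ \mu=\frac{\|a\|\|b\|}{|\langle x,b\rangle|}, \] and if $|\langle a,b\rangle||\langle x,b\rangle|\leq\|a\|\|b\||\langle y,b\rangle|$, put \[ \mu=\frac{|\langle a,b\rangle||\langle y,b\rangle|+\sqrt{\big(\|a\|^2\|b\|^2-|\langle a,b\rangle|^2\big)|\langle x,b\rangle|^2+\|a\|^2\|b\|^2|\langle y,b\rangle|^2}}{|\langle x,b\rangle|^2+|\langle y,b\rangle|^2}. \] Then \[ |\langle a,y\rangle|\leq\frac{\|x\|^2+\|y\|^2}{2}\,\mu. \] Moreover, $\mu$ is the minimum (in particular, it is attained) of the quotient \[ \frac{\|a\|\|b\|+|\lambda||\langle a,b\rangle|}{\left|\langle\sqrt{1-\lambda^2}\,x+\lambda y,\,b\rangle\right|} \] over all $\lambda\in[-1,1]$ for which the denominator is non-zero.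
   Context: The inner product $\langle\cdot,\cdot\rangle$ of $\mathcal{H}$ is linear in the first argument, and $\|\cdot\|$ is the induced norm. *)

theory Defs
  imports "HOL-Analysis.Analysis"
begin

text \<open>
  Complex inner product spaces on top of \<^class>\<open>real_normed_vector\<close>: the existing real structure is
  the restriction of scalars of the complex one, the existing norm is the one induced by the inner
  product, and the inner product is linear in the first argument.
\<close>

class complex_inner = real_normed_vector +
  fixes scaleC :: "complex \<Rightarrow> 'a \<Rightarrow> 'a" (infixr "*\<^sub>C" 75)
    and cinner :: "'a \<Rightarrow> 'a \<Rightarrow> complex"
  assumes scaleC_add_right: "c *\<^sub>C (x + y) = c *\<^sub>C x + c *\<^sub>C y"
    and scaleC_add_left: "(c + d) *\<^sub>C x = c *\<^sub>C x + d *\<^sub>C x"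
    and scaleC_scaleC: "c *\<^sub>C d *\<^sub>C x = (c * d) *\<^sub>C x"
    and scaleC_of_real: "complex_of_real r *\<^sub>C x = r *\<^sub>R x"
    and cinner_commute: "cinner x y = cnj (cinner y x)"
    and cinner_add_left: "cinner (x + y) z = cinner x z + cinner y z"
    and cinner_scaleC_left: "cinner (c *\<^sub>C x) y = c * cinner x y"
    and cinner_self_nonneg: "0 \<le> Re (cinner x x)"
    and cinner_eq_zero_iff: "cinner x x = 0 \<longleftrightarrow> x = 0"
    and norm_eq_sqrt_cinner: "norm x = sqrt (Re (cinner x x))"

class complex_hilbert_space = complex_inner + complete_space

end

theory Submission imports Defs begin

text \<open>
  Write \<open>c = (\<parallel>x\<parallel>\<^sup>2 + \<parallel>y\<parallel>\<^sup>2) / 2\<close>, \<open>s = \<surd>(1 - \<lambda>\<^sup>2)\<close> and \<open>w = s x + \<lambda> y\<close>. The inequality holds because it holds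
  with each quotient in place of \<open>\<mu>\<close>, that is,
  \<open>\<bar>\<langle>a, y\<rangle>\<bar> \<bar>\<langle>w, b\<rangle>\<bar> \<le> c (\<parallel>a\<parallel> \<parallel>b\<parallel> + \<bar>\<lambda>\<bar> \<bar>\<langle>a, b\<rangle>\<bar>)\<close>; at \<open>\<lambda> = \<plusminus>1\<close> this is Buzano's inequality.
  The left-hand side is \<open>\<bar>\<langle>S a, b\<rangle>\<bar>\<close> for the rank-one operator \<open>S = \<langle>\<cdot>, y\<rangle> w\<close>, and
  \<open>\<parallel>S - \<lambda> c I\<parallel> \<le> c\<close> (lemma \<open>norm_shifted_rank_one_le\<close>), so the bound follows from the
  triangle and Cauchy-Schwarz inequalities.

  For the minimum put \<open>A = \<parallel>a\<parallel> \<parallel>b\<parallel>\<close>, \<open>B = \<bar>\<langle>a, b\<rangle>\<bar>\<close>, \<open>P = \<bar>\<langle>x, b\<rangle>\<bar>\<close>, \<open>Q = \<bar>\<langle>y, b\<rangle>\<bar>\<close>. The denominator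
  is at most \<open>s P + \<bar>\<lambda>\<bar> Q\<close>. Since \<open>\<langle>x, b\<rangle>\<close> and \<open>\<langle>y, b\<rangle>\<close> are real multiples of a common complex
  number, one of the two signs of \<open>\<lambda>\<close> gives equality (lemma \<open>aligned_sign\<close>). It remains to minimise
  \<open>(A + t B) / (s P + t Q)\<close> over the quarter circle \<open>s, t \<ge> 0\<close>, \<open>s\<^sup>2 + t\<^sup>2 = 1\<close>. A number
  \<open>\<mu>\<close> is a lower bound iff \<open>s (\<mu> P) + t (\<mu> Q - B) \<le> A\<close> throughout. If \<open>\<mu> Q \<ge> B\<close> at
  the critical value, the maximum of the left-hand side is the length of \<open>(\<mu> P, \<mu> Q - B)\<close>, so \<open>\<mu>\<close> is
  the larger root of \<open>(\<mu> P)\<^sup>2 + (\<mu> Q - B)\<^sup>2 = A\<^sup>2\<close>; otherwise the maximum is at the end point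
  \<open>(s, t) = (1, 0)\<close> and \<open>\<mu> = A / P\<close>. The two cases are separated by the sign of \<open>A Q - B P\<close>.
\<close>

section \<open>Complex inner products\<close>

lemma cinner_add_right: "cinner x (y + z) = cinner x y + cinner (x::'a::complex_inner) z"
  by (metis cinner_add_left cinner_commute complex_cnj_add)

lemma cinner_scaleR_left: "cinner (r *\<^sub>R x) y = of_real r * cinner (x::'a::complex_inner) y"
  by (metis cinner_scaleC_left scaleC_of_real)

lemma cinner_minus_left: "cinner (- x) y = - cinner (x::'a::complex_inner) y"
  using cinner_scaleR_left[of "-1" x y] by simp

lemma cinner_diff_left: "cinner (x - y) z = cinner x z - cinner (y::'a::complex_inner) z"
  using cinner_add_left[of x "- y" z] by (simp add: cinner_minus_left)

lemma cinner_self: "cinner x x = of_real ((norm (x::'a::complex_inner))\<^sup>2)"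
proof -
  have "Im (cinner x x) = 0"
    using arg_cong[OF cinner_commute[of x x], of Im] by simp
  moreover have "Re (cinner x x) = (norm x)\<^sup>2"
    by (simp add: norm_eq_sqrt_cinner cinner_self_nonneg)
  ultimately show ?thesis
    by (simp add: complex_eq_iff)
qed

lemma norm_scaleC: "norm (c *\<^sub>C x) = cmod c * norm (x::'a::complex_inner)"
proof -
  have "cinner (c *\<^sub>C x) (c *\<^sub>C x) = c * cnj c * cinner x x"
    by (metis cinner_commute cinner_scaleC_left complex_cnj_mult mult.assoc)
  then have "complex_of_real ((norm (c *\<^sub>C x))\<^sup>2) = of_real ((cmod c * norm x)\<^sup>2)"
    by (simp only: cinner_self complex_norm_square[symmetric] power_mult_distrib
        of_real_mult of_real_power)
  then have "(norm (c *\<^sub>C x))\<^sup>2 = (cmod c * norm x)\<^sup>2"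
    using of_real_eq_iff by blast
  then show ?thesis
    by (simp add: power2_eq_iff_nonneg)
qed

lemma norm_diff_squared:
  "(norm (x - y))\<^sup>2 = (norm x)\<^sup>2 + (norm y)\<^sup>2 - 2 * Re (cinner y (x::'a::complex_inner))"
proof -
  have e: "cinner u (x - y) = cinner u x - cinner u y" for u
    by (metis cinner_commute cinner_diff_left complex_cnj_diff)
  have "cinner (x - y) (x - y) = cinner x x + cinner y y - (cinner y x + cnj (cinner y x))"
    by (simp add: e cinner_diff_left cinner_commute[of x y])
  then have "complex_of_real ((norm (x - y))\<^sup>2)
      = of_real ((norm x)\<^sup>2 + (norm y)\<^sup>2 - 2 * Re (cinner y x))"
    by (simp add: cinner_self complex_add_cnj)
  then show ?thesis
    using of_real_eq_iff by blast
qed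

lemma Re_cinner_commute: "Re (cinner x y) = Re (cinner y (x::'a::complex_inner))"
  using arg_cong[OF cinner_commute[of x y], of Re] by simp

lemma cinner_component_real:
  "Re (cinner (cinner a y *\<^sub>C y) (a::'a::complex_inner)) = (cmod (cinner a y))\<^sup>2"
  by (simp only: cinner_scaleC_left cinner_commute[of y a] complex_norm_square[symmetric]
      Re_complex_of_real flip: of_real_power)

text \<open>
  The vector \<open>\<langle>a, b\<rangle> b - \<parallel>b\<parallel>\<^sup>2 a\<close>, a multiple of the component of \<open>a\<close> orthogonal to \<open>b\<close>, has
  squared length \<open>\<parallel>b\<parallel>\<^sup>2 (\<parallel>a\<parallel>\<^sup>2 \<parallel>b\<parallel>\<^sup>2 - \<bar>\<langle>a, b\<rangle>\<bar>\<^sup>2)\<close>.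
\<close>

lemma cinner_Cauchy_Schwarz: "cmod (cinner a b) \<le> norm (a::'a::complex_inner) * norm b"
proof (cases "b = 0")
  case True
  have "cinner a 0 = 0"
    using cinner_add_right[of a 0 0] by simp
  then show ?thesis
    by (simp add: True)
next
  case False
  let ?k = "cmod (cinner a b)" and ?n = "norm b"
  have "Re (cinner (?n\<^sup>2 *\<^sub>R a) (cinner a b *\<^sub>C b))
      = ?n\<^sup>2 * Re (cinner (cinner a b *\<^sub>C b) a)"
    by (simp add: cinner_scaleR_left Re_cinner_commute[of a] flip: of_real_power)
  then have "(norm (cinner a b *\<^sub>C b - ?n\<^sup>2 *\<^sub>R a))\<^sup>2
      = ?k\<^sup>2 * ?n\<^sup>2 + (?n\<^sup>2)\<^sup>2 * (norm a)\<^sup>2 - 2 * (?n\<^sup>2 * ?k\<^sup>2)"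
    by (simp add: norm_diff_squared norm_scaleC cinner_component_real power_mult_distrib)
  also have "\<dots> = ?n\<^sup>2 * ((norm a * ?n)\<^sup>2 - ?k\<^sup>2)"
    by (simp add: algebra_simps power2_eq_square)
  finally have "0 \<le> ?n\<^sup>2 * ((norm a * ?n)\<^sup>2 - ?k\<^sup>2)"
    by (metis zero_le_power2)
  then have "?k\<^sup>2 \<le> (norm a * ?n)\<^sup>2"
    using False by (simp add: zero_le_mult_iff)
  then show ?thesis
    by (rule power2_le_imp_le) simp
qed

section \<open>The interpolated Buzano inequality\<close>

lemma norm_circle_combination_le:
  fixes u v :: "'a::real_normed_vector"
  assumes "s\<^sup>2 + t\<^sup>2 = 1"
  shows "(norm (s *\<^sub>R u + t *\<^sub>R v))\<^sup>2 \<le> (norm u)\<^sup>2 + (norm v)\<^sup>2"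
proof -
  have "norm (s *\<^sub>R u + t *\<^sub>R v) \<le> \<bar>s\<bar> * norm u + \<bar>t\<bar> * norm v"
    using norm_triangle_ineq[of "s *\<^sub>R u" "t *\<^sub>R v"] by simp
  then have "(norm (s *\<^sub>R u + t *\<^sub>R v))\<^sup>2 \<le> (\<bar>s\<bar> * norm u + \<bar>t\<bar> * norm v)\<^sup>2"
    by (rule power_mono) simp
  also have "\<dots> \<le> (\<bar>s\<bar> * norm u + \<bar>t\<bar> * norm v)\<^sup>2 + (\<bar>t\<bar> * norm u - \<bar>s\<bar> * norm v)\<^sup>2"
    by simp
  also have "\<dots> = (s\<^sup>2 + t\<^sup>2) * ((norm u)\<^sup>2 + (norm v)\<^sup>2)"
    by (simp add: power2_sum power2_diff power_mult_distrib algebra_simps)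
  finally show ?thesis
    using assms by simp
qed

text \<open>
  With \<open>k = \<langle>a, y\<rangle>\<close> the vector is \<open>s (k x) + t (k y - c a)\<close>. The shift by \<open>c\<close> is chosen so that
  in \<open>\<parallel>k x\<parallel>\<^sup>2 + \<parallel>k y - c a\<parallel>\<^sup>2 = \<bar>k\<bar>\<^sup>2 (\<parallel>x\<parallel>\<^sup>2 + \<parallel>y\<parallel>\<^sup>2 - 2 c) + c\<^sup>2 \<parallel>a\<parallel>\<^sup>2\<close> the terms in \<open>\<bar>k\<bar>\<^sup>2\<close> cancel.
\<close>

lemma norm_shifted_rank_one_le:
  fixes a x y :: "'a::complex_inner"
  assumes "s\<^sup>2 + t\<^sup>2 = 1" and c: "c = ((norm x)\<^sup>2 + (norm y)\<^sup>2) / 2"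
  shows "norm (s *\<^sub>R (cinner a y *\<^sub>C x) + t *\<^sub>R (cinner a y *\<^sub>C y - c *\<^sub>R a)) \<le> c * norm a"
proof -
  let ?k = "cinner a y"
  have re: "Re (cinner (c *\<^sub>R a) (?k *\<^sub>C y)) = c * (cmod ?k)\<^sup>2"
    by (simp add: cinner_scaleR_left Re_cinner_commute[of a] cinner_component_real)
  have "(norm (s *\<^sub>R (?k *\<^sub>C x) + t *\<^sub>R (?k *\<^sub>C y - c *\<^sub>R a)))\<^sup>2
      \<le> (norm (?k *\<^sub>C x))\<^sup>2 + (norm (?k *\<^sub>C y - c *\<^sub>R a))\<^sup>2"
    by (rule norm_circle_combination_le[OF assms(1)])
  also have "\<dots> = (cmod ?k)\<^sup>2 * ((norm x)\<^sup>2 + (norm y)\<^sup>2 - 2 * c) + (c * norm a)\<^sup>2"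
    by (simp add: norm_diff_squared re norm_scaleC power_mult_distrib algebra_simps)
  also have "\<dots> = (c * norm a)\<^sup>2"
    by (simp add: c)
  finally show ?thesis
    by (rule power2_le_imp_le) (simp add: c)
qed

text \<open>
  The product on the left is \<open>\<bar>\<langle>S a, b\<rangle>\<bar>\<close> with \<open>S = \<langle>\<cdot>, y\<rangle> (s x + t y)\<close>. Splitting
  \<open>S = (S - t c I) + t c I\<close>, where \<open>c = (\<parallel>x\<parallel>\<^sup>2 + \<parallel>y\<parallel>\<^sup>2) / 2\<close>, gives the two terms on the right.
\<close>

lemma interpolated_Buzano:
  fixes a b x y :: "'a::complex_inner"
  assumes "s\<^sup>2 + t\<^sup>2 = 1"
  shows "cmod (cinner a y) * cmod (cinner (s *\<^sub>R x + t *\<^sub>R y) b)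
    \<le> ((norm x)\<^sup>2 + (norm y)\<^sup>2) / 2 * (norm a * norm b + \<bar>t\<bar> * cmod (cinner a b))"
proof -
  define c where "c = ((norm x)\<^sup>2 + (norm y)\<^sup>2) / 2"
  define z where "z = s *\<^sub>R (cinner a y *\<^sub>C x) + t *\<^sub>R (cinner a y *\<^sub>C y - c *\<^sub>R a)"
  have c0: "0 \<le> c"
    by (simp add: c_def)
  have "cinner a y * cinner (s *\<^sub>R x + t *\<^sub>R y) b
      = cinner z b + of_real (t * c) * cinner a b"
    unfolding z_def
    by (simp add: cinner_add_left cinner_diff_left cinner_scaleR_left cinner_scaleC_left
        algebra_simps)
  then have "cmod (cinner a y) * cmod (cinner (s *\<^sub>R x + t *\<^sub>R y) b)
      = cmod (cinner z b + of_real (t * c) * cinner a b)"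
    by (metis norm_mult)
  also have "\<dots> \<le> cmod (cinner z b) + \<bar>t\<bar> * c * cmod (cinner a b)"
    using norm_triangle_ineq[of "cinner z b" "of_real (t * c) * cinner a b"] c0
    by (simp add: norm_mult abs_mult)
  also have "cmod (cinner z b) \<le> norm z * norm b"
    by (rule cinner_Cauchy_Schwarz)
  also have "norm z * norm b \<le> c * norm a * norm b"
    using norm_shifted_rank_one_le[OF assms c_def] unfolding z_def
    by (rule mult_right_mono) simp
  finally show ?thesis
    unfolding c_def[symmetric] by (simp add: algebra_simps)
qed

section \<open>Minimising over the quarter circle\<close>

text \<open>
  As \<open>p\<close> and \<open>q\<close> lie on one real line through the origin, the right sign of \<open>q\<close> makes them point in
  the same direction, and then the triangle inequality is an equality.
\<close>

lemma aligned_sign: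
  assumes "p * cnj q \<in> \<real>"
  obtains e :: real where "\<bar>e\<bar> = 1"
    and "\<And>s t. 0 \<le> s \<Longrightarrow> 0 \<le> t \<Longrightarrow>
      cmod (of_real s * p + of_real (e * t) * q) = s * cmod p + t * cmod q"
proof -
  obtain r where r: "p * cnj q = of_real r"
    using assms by (auto elim: Reals_cases)
  have abs_r: "\<bar>r\<bar> = cmod p * cmod q"
    using arg_cong[OF r, of cmod] by (simp add: norm_mult)
  define e :: real where "e = (if 0 \<le> r then 1 else -1)"
  have er: "e * r = cmod p * cmod q"
    using abs_r by (auto simp: e_def)
  have e2: "e * e = 1"
    by (simp add: e_def)
  have re: "Re p * Re q + Im p * Im q = r"
    using arg_cong[OF r, of Re] by simp
  have "cmod (of_real s * p + of_real (e * t) * q) = s * cmod p + t * cmod q"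
    if "0 \<le> s" "0 \<le> t" for s t
  proof -
    have "(cmod (of_real s * p + of_real (e * t) * q))\<^sup>2
        = s\<^sup>2 * ((Re p)\<^sup>2 + (Im p)\<^sup>2) + (e * e) * t\<^sup>2 * ((Re q)\<^sup>2 + (Im q)\<^sup>2)
          + 2 * s * t * (e * (Re p * Re q + Im p * Im q))"
      unfolding cmod_power2 by (simp add: power2_eq_square algebra_simps)
    also have "\<dots> = (s * cmod p + t * cmod q)\<^sup>2"
      unfolding re er e2 cmod_power2[symmetric]
      by (simp add: power2_eq_square algebra_simps)
    finally show ?thesis
      using that by (simp add: power2_eq_iff_nonneg)
  qed
  then show thesis
    using that[of e] by (simp add: e_def)
qed

text \<open>
  The formula is the larger root of the quadratic equation saying that \<open>(\<mu> P, \<mu> Q - B)\<close> has length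
  \<open>A\<close>. The bound \<open>B \<le> \<mu> Q\<close>, which places this vector in the quadrant of the quarter circle,
  becomes \<open>(P\<^sup>2 + Q\<^sup>2) (B P)\<^sup>2 \<le> (P\<^sup>2 + Q\<^sup>2) (A Q)\<^sup>2\<close> after isolating the root and squaring.
\<close>

lemma critical_value:
  fixes A B P Q \<mu> :: real
  assumes "0 \<le> B" "B \<le> A" "0 \<le> P" "0 \<le> Q" and nz: "P \<noteq> 0 \<or> Q \<noteq> 0"
    and le: "B * P \<le> A * Q"
    and mu: "\<mu> = (B * Q + sqrt ((A\<^sup>2 - B\<^sup>2) * P\<^sup>2 + A\<^sup>2 * Q\<^sup>2)) / (P\<^sup>2 + Q\<^sup>2)"
  shows "(\<mu> * P)\<^sup>2 + (\<mu> * Q - B)\<^sup>2 = A\<^sup>2" and "B \<le> \<mu> * Q" and "0 \<le> \<mu>"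
proof -
  define N where "N = P\<^sup>2 + Q\<^sup>2"
  define D where "D = (A\<^sup>2 - B\<^sup>2) * P\<^sup>2 + A\<^sup>2 * Q\<^sup>2"
  have N: "0 < N"
    unfolding N_def using nz by (metis sum_power2_gt_zero_iff)
  have "B\<^sup>2 \<le> A\<^sup>2"
    using assms by (simp add: power_mono)
  then have D: "0 \<le> D"
    by (simp add: D_def)
  have mN: "\<mu> * N = B * Q + sqrt D"
    using N unfolding mu N_def[symmetric] D_def[symmetric] by simp
  show "0 \<le> \<mu>"
    using N D assms(1,4) unfolding mu N_def[symmetric] D_def[symmetric] by simp
  have "(\<mu> * N - B * Q)\<^sup>2 = D"
    using mN D by simp
  then have "N * (\<mu>\<^sup>2 * N - 2 * \<mu> * B * Q + B\<^sup>2 - A\<^sup>2) = 0"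
    unfolding D_def N_def by (simp add: power2_eq_square algebra_simps)
  then have "\<mu>\<^sup>2 * N - 2 * \<mu> * B * Q + B\<^sup>2 - A\<^sup>2 = 0"
    using N by simp
  then show "(\<mu> * P)\<^sup>2 + (\<mu> * Q - B)\<^sup>2 = A\<^sup>2"
    unfolding N_def by (simp add: power2_eq_square algebra_simps)
  have "(B * P)\<^sup>2 \<le> (A * Q)\<^sup>2"
    using assms by (intro power_mono) auto
  then have "N * (B * P)\<^sup>2 \<le> N * (A * Q)\<^sup>2"
    using N by simp
  then have "(B * P\<^sup>2)\<^sup>2 \<le> Q\<^sup>2 * D"
    unfolding N_def D_def by (simp add: power2_eq_square algebra_simps)
  then have "B * P\<^sup>2 \<le> sqrt (Q\<^sup>2 * D)"
    by (rule real_le_rsqrt)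
  then have "B * P\<^sup>2 \<le> Q * sqrt D"
    using assms(4) by (simp add: real_sqrt_mult)
  then have "B * N \<le> Q * (\<mu> * N)"
    unfolding mN by (simp add: N_def power2_eq_square algebra_simps)
  then have "N * B \<le> N * (\<mu> * Q)"
    by (simp add: algebra_simps)
  then show "B \<le> \<mu> * Q"
    using N by simp
qed

text \<open>
  Both cases bound the linear form \<open>s (\<mu> P) + t (\<mu> Q - B)\<close> by \<open>A\<close>. If \<open>A Q < B P\<close>, its second
  coefficient is not positive, so \<open>(s, t) = (1, 0)\<close> is optimal; otherwise the bound is
  Cauchy-Schwarz in the plane, with equality on the ray through \<open>(\<mu> P, \<mu> Q - B)\<close>.
\<close>

lemma quarter_circle_minimum:
  fixes A B P Q \<mu> :: real
  assumes B: "0 \<le> B" "B \<le> A" and PQ: "0 \<le> P" "0 \<le> Q" and nz: "P \<noteq> 0 \<or> Q \<noteq> 0"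
    and gt: "A * Q < B * P \<Longrightarrow> \<mu> = A / P"
    and le: "B * P \<le> A * Q \<Longrightarrow>
      \<mu> = (B * Q + sqrt ((A\<^sup>2 - B\<^sup>2) * P\<^sup>2 + A\<^sup>2 * Q\<^sup>2)) / (P\<^sup>2 + Q\<^sup>2)"
  shows quarter_circle_minimum_nonneg: "0 \<le> \<mu>"
    and quarter_circle_lower_bound:
      "\<And>s t. 0 \<le> s \<Longrightarrow> 0 \<le> t \<Longrightarrow> s\<^sup>2 + t\<^sup>2 = 1 \<Longrightarrow> \<mu> * (s * P + t * Q) \<le> A + t * B"
    and quarter_circle_minimum_attained:
      "\<exists>s t. 0 \<le> s \<and> 0 \<le> t \<and> s\<^sup>2 + t\<^sup>2 = 1 \<and> 0 < s * P + t * Q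
        \<and> \<mu> * (s * P + t * Q) = A + t * B"
proof -
  have "0 \<le> \<mu>
    \<and> (\<forall>s t. 0 \<le> s \<longrightarrow> 0 \<le> t \<longrightarrow> s\<^sup>2 + t\<^sup>2 = 1 \<longrightarrow> \<mu> * (s * P + t * Q) \<le> A + t * B)
    \<and> (\<exists>s t. 0 \<le> s \<and> 0 \<le> t \<and> s\<^sup>2 + t\<^sup>2 = 1 \<and> 0 < s * P + t * Q
        \<and> \<mu> * (s * P + t * Q) = A + t * B)"
  proof (cases "A * Q < B * P")
    case True
    have "0 \<le> A * Q"
      using B PQ by simp
    then have P: "0 < P"
      using True PQ by (cases "P = 0") auto
    have mu: "\<mu> * P = A" "0 \<le> \<mu>"
      using gt[OF True] P B by auto
    have "P * (\<mu> * Q) = A * Q"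
      by (simp flip: mu(1))
    then have "P * (\<mu> * Q) < P * B"
      using True by (simp only: mult.commute[of P B])
    then have muQ: "\<mu> * Q \<le> B"
      using P by simp
    have "\<mu> * (s * P + t * Q) \<le> A + t * B"
      if "0 \<le> s" "0 \<le> t" "s\<^sup>2 + t\<^sup>2 = 1" for s t
    proof -
      have "s\<^sup>2 \<le> 1\<^sup>2"
        using that(3) zero_le_power2[of t] unfolding one_power2 by linarith
      then have "s \<le> 1"
        by (rule power2_le_imp_le) simp
      then have "s * A \<le> 1 * A"
        using B by (intro mult_right_mono) auto
      moreover have "t * (\<mu> * Q) \<le> t * B"
        using muQ that(2) by (rule mult_left_mono)
      moreover have "\<mu> * (s * P + t * Q) = s * A + t * (\<mu> * Q)"
        by (simp add: mu(1)[symmetric] algebra_simps)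
      ultimately show ?thesis
        by simp
    qed
    moreover have "0 \<le> (1::real) \<and> 0 \<le> (0::real) \<and> 1\<^sup>2 + 0\<^sup>2 = (1::real) \<and> 0 < 1 * P + 0 * Q
        \<and> \<mu> * (1 * P + 0 * Q) = A + 0 * B"
      using P mu(1) by simp
    ultimately show ?thesis
      using mu(2) by blast
  next
    case False
    then have BP: "B * P \<le> A * Q"
      by simp
    note crit = critical_value[OF B PQ nz BP le[OF BP]]
    have A: "0 \<le> A"
      using B by simp
    have "\<mu> * (s * P + t * Q) \<le> A + t * B"
      if "0 \<le> s" "0 \<le> t" and circle: "s\<^sup>2 + t\<^sup>2 = 1" for s t
    proof -
      have "(s * (\<mu> * P) + t * (\<mu> * Q - B))\<^sup>2 \<le> A\<^sup>2"
        using norm_circle_combination_le[OF circle, of "\<mu> * P" "\<mu> * Q - B"] crit(1)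
        by simp
      then have "s * (\<mu> * P) + t * (\<mu> * Q - B) \<le> A"
        using A by (rule power2_le_imp_le)
      then show ?thesis
        by (simp add: algebra_simps)
    qed
    moreover have "\<exists>s t. 0 \<le> s \<and> 0 \<le> t \<and> s\<^sup>2 + t\<^sup>2 = 1 \<and> 0 < s * P + t * Q
        \<and> \<mu> * (s * P + t * Q) = A + t * B"
    proof (cases "A = 0")
      case True
      then have "B = 0"
        using B by simp
      then have "\<mu> = 0"
        using le[OF BP] True by simp
      \<comment> \<open>All quotients vanish, so any point with a positive denominator will do.\<close>
      show ?thesis
      proof (cases "P = 0")
        case True
        then show ?thesis
          using \<open>A = 0\<close> \<open>B = 0\<close> \<open>\<mu> = 0\<close> nz PQ
          by (intro exI[of _ "0::real"] exI[of _ "1::real"]) simp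
      next
        case False
        then show ?thesis
          using \<open>A = 0\<close> \<open>B = 0\<close> \<open>\<mu> = 0\<close> PQ
          by (intro exI[of _ "1::real"] exI[of _ "0::real"]) simp
      qed
    next
      case False
      with A have Apos: "0 < A"
        by simp
      \<comment> \<open>Equality in Cauchy-Schwarz: the unit vector in the direction \<open>(\<mu> P, \<mu> Q - B)\<close>.\<close>
      define s where "s = \<mu> * P / A"
      define t where "t = (\<mu> * Q - B) / A"
      have st: "0 \<le> s" "0 \<le> t"
        using crit(2,3) PQ Apos by (simp_all add: s_def t_def)
      have "s\<^sup>2 + t\<^sup>2 = ((\<mu> * P)\<^sup>2 + (\<mu> * Q - B)\<^sup>2) / A\<^sup>2"
        by (simp add: s_def t_def power_divide add_divide_distrib)
      then have circle: "s\<^sup>2 + t\<^sup>2 = 1"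
        using crit(1) Apos by simp
      have "s * (\<mu> * P) + t * (\<mu> * Q - B) = ((\<mu> * P)\<^sup>2 + (\<mu> * Q - B)\<^sup>2) / A"
        by (simp add: s_def t_def power2_eq_square add_divide_distrib)
      also have "\<dots> = A"
        using crit(1) Apos by (simp add: power2_eq_square)
      finally have eq: "\<mu> * (s * P + t * Q) = A + t * B"
        by (simp add: algebra_simps)
      moreover have "0 < A + t * B"
        using Apos st(2) B(1) by (simp add: add_pos_nonneg)
      ultimately have "0 < s * P + t * Q"
        using crit(3) by (metis zero_less_mult_pos not_less_iff_gr_or_eq mult_zero_left less_le)
      then show ?thesis
        using st circle eq by blast
    qed
    ultimately show ?thesis
      using crit(3) by blast
  qed
  then show "0 \<le> \<mu>"
    and "\<And>s t. 0 \<le> s \<Longrightarrow> 0 \<le> t \<Longrightarrow> s\<^sup>2 + t\<^sup>2 = 1 \<Longrightarrow> \<mu> * (s * P + t * Q) \<le> A + t * B"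
    and "\<exists>s t. 0 \<le> s \<and> 0 \<le> t \<and> s\<^sup>2 + t\<^sup>2 = 1 \<and> 0 < s * P + t * Q
        \<and> \<mu> * (s * P + t * Q) = A + t * B"
    by blast+
qed

section \<open>The optimal bound\<close>

theorem theorem2p3:
  fixes a b x y :: "'a::complex_hilbert_space" and \<mu> :: real
  assumes real_prod: "cinner x b * cinner b y \<in> \<real>"
    and nonzero: "(cinner x b, cinner y b) \<noteq> (0, 0)"
    and mu_gt: "cmod (cinner a b) * cmod (cinner x b) > norm a * norm b * cmod (cinner y b) \<Longrightarrow>
      \<mu> = norm a * norm b / cmod (cinner x b)"
    and mu_le: "cmod (cinner a b) * cmod (cinner x b) \<le> norm a * norm b * cmod (cinner y b) \<Longrightarrow>
      \<mu> = (cmod (cinner a b) * cmod (cinner y b)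
            + sqrt (((norm a)\<^sup>2 * (norm b)\<^sup>2 - (cmod (cinner a b))\<^sup>2) * (cmod (cinner x b))\<^sup>2
                    + (norm a)\<^sup>2 * (norm b)\<^sup>2 * (cmod (cinner y b))\<^sup>2))
          / ((cmod (cinner x b))\<^sup>2 + (cmod (cinner y b))\<^sup>2)"
  shows "cmod (cinner a y) \<le> ((norm x)\<^sup>2 + (norm y)\<^sup>2) / 2 * \<mu>
    \<and> (\<exists>l\<in>{-1..1::real}. cinner (sqrt (1 - l\<^sup>2) *\<^sub>R x + l *\<^sub>R y) b \<noteq> 0
        \<and> \<mu> = (norm a * norm b + \<bar>l\<bar> * cmod (cinner a b))
              / cmod (cinner (sqrt (1 - l\<^sup>2) *\<^sub>R x + l *\<^sub>R y) b))
    \<and> (\<forall>l\<in>{-1..1::real}. cinner (sqrt (1 - l\<^sup>2) *\<^sub>R x + l *\<^sub>R y) b \<noteq> 0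
        \<longrightarrow> \<mu> \<le> (norm a * norm b + \<bar>l\<bar> * cmod (cinner a b))
              / cmod (cinner (sqrt (1 - l\<^sup>2) *\<^sub>R x + l *\<^sub>R y) b))"
proof -
  define A where "A = norm a * norm b"
  define B where "B = cmod (cinner a b)"
  define P where "P = cmod (cinner x b)"
  define Q where "Q = cmod (cinner y b)"
  define den where "den l = cmod (cinner (sqrt (1 - l\<^sup>2) *\<^sub>R x + l *\<^sub>R y) b)" for l
  have B: "0 \<le> B" "B \<le> A"
    by (simp_all add: A_def B_def cinner_Cauchy_Schwarz)
  have PQ: "0 \<le> P" "0 \<le> Q" "P \<noteq> 0 \<or> Q \<noteq> 0"
    using nonzero by (simp_all add: P_def Q_def)
  have mu1: "\<mu> = A / P" if "A * Q < B * P"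
    using mu_gt that by (simp add: A_def B_def P_def Q_def)
  have mu2: "\<mu> = (B * Q + sqrt ((A\<^sup>2 - B\<^sup>2) * P\<^sup>2 + A\<^sup>2 * Q\<^sup>2)) / (P\<^sup>2 + Q\<^sup>2)"
    if "B * P \<le> A * Q"
    using mu_le that by (simp add: A_def B_def P_def Q_def power_mult_distrib)
  note min = quarter_circle_minimum[OF B PQ mu1 mu2]
  have cinner_comb: "cinner (s *\<^sub>R x + t *\<^sub>R y) b
      = of_real s * cinner x b + of_real t * cinner y b" for s t
    by (simp add: cinner_add_left cinner_scaleR_left)
  have unit_square: "l\<^sup>2 \<le> 1" if "l \<in> {-1..1}" for l :: real
    using that abs_square_le_1[of l] by (simp add: abs_le_iff)
  then have circle: "(sqrt (1 - l\<^sup>2))\<^sup>2 + l\<^sup>2 = 1" if "l \<in> {-1..1}" for l :: real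
    using unit_square[OF that] by simp

  have lower: "\<mu> * den l \<le> A + \<bar>l\<bar> * B" if l: "l \<in> {-1..1}" for l
  proof -
    have "den l \<le> sqrt (1 - l\<^sup>2) * P + \<bar>l\<bar> * Q"
      unfolding den_def cinner_comb P_def Q_def
      using norm_triangle_ineq[of "of_real (sqrt (1 - l\<^sup>2)) * cinner x b"
          "of_real l * cinner y b"] unit_square[OF l]
      by (simp add: norm_mult)
    then have "\<mu> * den l \<le> \<mu> * (sqrt (1 - l\<^sup>2) * P + \<bar>l\<bar> * Q)"
      using min(1) by (rule mult_left_mono)
    also have "\<dots> \<le> A + \<bar>l\<bar> * B"
      using circle[OF l] unit_square[OF l] by (intro min(2)) auto
    finally show ?thesis .
  qed

  have "cinner x b * cnj (cinner y b) \<in> \<real>"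
    using real_prod by (simp add: cinner_commute[of b y])
  then obtain e :: real where e: "\<bar>e\<bar> = 1"
    and aligned: "\<And>s t. 0 \<le> s \<Longrightarrow> 0 \<le> t \<Longrightarrow>
      cmod (of_real s * cinner x b + of_real (e * t) * cinner y b) = s * P + t * Q"
    unfolding P_def Q_def using aligned_sign by metis
  obtain s t where st: "0 \<le> s" "0 \<le> t" "s\<^sup>2 + t\<^sup>2 = 1" and pos: "0 < s * P + t * Q"
    and eq: "\<mu> * (s * P + t * Q) = A + t * B"
    using min(3) by blast
  define l where "l = e * t"
  have abs_l: "\<bar>l\<bar> = t"
    using e st(2) by (simp add: l_def abs_mult)
  have "l\<^sup>2 = t\<^sup>2"
    using abs_l by (metis power2_abs)
  then have sqrt_l: "sqrt (1 - l\<^sup>2) = s"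
    using st by (intro real_sqrt_unique) auto
  have "t\<^sup>2 \<le> 1\<^sup>2"
    using st(3) zero_le_power2[of s] unfolding one_power2 by linarith
  then have "t \<le> 1"
    by (rule power2_le_imp_le) simp
  then have l: "l \<in> {-1..1}"
    using abs_l by auto
  have den_l: "den l = s * P + t * Q"
    unfolding den_def sqrt_l cinner_comb unfolding l_def by (rule aligned[OF st(1,2)])
  have mu_l: "\<mu> = (A + \<bar>l\<bar> * B) / den l"
    using eq pos by (simp add: den_l abs_l field_simps)

  have "cmod (cinner a y) * den l \<le> ((norm x)\<^sup>2 + (norm y)\<^sup>2) / 2 * (A + \<bar>l\<bar> * B)"
    unfolding den_def A_def B_def by (rule interpolated_Buzano[OF circle[OF l]])
  then have "cmod (cinner a y) \<le> ((norm x)\<^sup>2 + (norm y)\<^sup>2) / 2 * (A + \<bar>l\<bar> * B) / den l"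
    using pos by (simp only: den_l pos_le_divide_eq)
  then have "cmod (cinner a y) \<le> ((norm x)\<^sup>2 + (norm y)\<^sup>2) / 2 * \<mu>"
    by (simp add: mu_l)
  moreover have "den l \<noteq> 0"
    using pos by (simp add: den_l)
  moreover have "\<mu> \<le> (A + \<bar>l\<bar> * B) / den l" if "l \<in> {-1..1}" "den l \<noteq> 0" for l
  proof -
    have "0 < den l"
      using that(2) by (simp add: den_def)
    then show ?thesis
      using lower[OF that(1)] by (simp add: pos_le_divide_eq)
  qed
  ultimately show ?thesis
    using l mu_l unfolding A_def B_def den_def norm_eq_zero by blast
qed

end
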